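(* Let $Q=abcd$. For any non-negative integer $N$ and $\nu\in\{0,1\}$, $$\sum_{\pi\in\mathcal{S}^2_{2N+\nu,\infty}}\omega^2_\pi(a,b,c,d)=\sum_{i=0}^N\frac{(-a;Q)_{N-i+\nu}(-c;Q)_i(ab)^i}{(Q;Q)_{N-i}(Q;Q)_i}=\frac{1}{(Q;Q)_N}\sum_{i=0}^N\begin{bmatrix}N\\ i\end{bmatrix}_Q(-a;Q)_{N-i+\nu}(-c;Q)_i(ab)^i.$$
   Context: $\mathcal{S}^2_{M,\infty}$ is the set of partitions whose odd parts are all distinct and whose largest part is $\le M$ (empty partition included). The weight $\omega^2_\pi(a,b,c,d)$ is the product of labels when cells of each odd-indexed row of the Ferrers diagram of $\pi$ (top row indexed 1) are labelled left to right alternately $a,b,a,b,\dots$ and cells of each even-indexed row alternately $c,d,c,d,\dots$. $(x;q)_n=\prod_{k=1}^n(1-xq^{k-1})$, $\begin{bmatrix}n\\ k\end{bmatrix}_q=\frac{(q;q)_n}{(q;q)_k(q;q)_{n-k}}$ for $0\le k\le n$. *)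

theory Defs
  imports "HOL-Analysis.Analysis"
begin

text \<open>A partition is the weakly decreasing list of its parts; the empty list is the empty
  partition.\<close>

definition is_partition :: "nat list \<Rightarrow> bool" where
  "is_partition \<pi> \<longleftrightarrow> sorted_wrt (\<ge>) \<pi> \<and> (\<forall>p \<in> set \<pi>. 0 < p)"

definition S2 :: "nat \<Rightarrow> nat list set" where
  "S2 M = {\<pi>. is_partition \<pi> \<and> (\<forall>p \<in> set \<pi>. odd p \<longrightarrow> count_list \<pi> p = 1)
                \<and> (\<forall>p \<in> set \<pi>. p \<le> M)}"

text \<open>Cells are pairs (row, column), both counted from 1, whereas list positions are counted
  from 0.\<close>

definition ferrers_cells :: "nat list \<Rightarrow> (nat \<times> nat) set" where
  "ferrers_cells \<pi> = (SIGMA i:{1..length \<pi>}. {1..\<pi> ! (i - 1)})"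

definition cell_label :: "'a \<Rightarrow> 'a \<Rightarrow> 'a \<Rightarrow> 'a \<Rightarrow> nat \<times> nat \<Rightarrow> 'a" where
  "cell_label a b c d = (\<lambda>(i, j).
     if odd i then (if odd j then a else b) else (if odd j then c else d))"

definition weight2 :: "nat list \<Rightarrow> 'a::comm_monoid_mult \<Rightarrow> 'a \<Rightarrow> 'a \<Rightarrow> 'a \<Rightarrow> 'a" where
  "weight2 \<pi> a b c d = (\<Prod>x \<in> ferrers_cells \<pi>. cell_label a b c d x)"

definition qpoch :: "'a::comm_ring_1 \<Rightarrow> 'a \<Rightarrow> nat \<Rightarrow> 'a" where
  "qpoch x q n = (\<Prod>k = 1..n. 1 - x * q ^ (k - 1))"

text \<open>Only the range \<open>k \<le> n\<close> matters; the value 0 outside it is a convention.\<close>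

definition qbinom :: "'a::field \<Rightarrow> nat \<Rightarrow> nat \<Rightarrow> 'a" where
  "qbinom q n k = (if k \<le> n then qpoch q q n / (qpoch q q k * qpoch q q (n - k)) else 0)"

end

theory Submission
  imports Defs
begin

text \<open>Let \<open>F M\<close> be the generating function of \<open>S2 M\<close> and \<open>F' M\<close> the one with \<open>(a, b)\<close> and
  \<open>(c, d)\<close> exchanged; removing the first row of a diagram exchanges the two. An odd largest part
  occurs at most once, so \<open>F (2N+1) = F (2N) + a (ab)^N F' (2N)\<close>. Two copies of the part \<open>2N\<close> on
  top contribute \<open>Q^N\<close> and do not exchange labels, so summing a geometric series over the number
  of such pairs gives \<open>(1 - Q^N) F (2N) = F (2N-1) + (ab)^N F' (2N-1)\<close>. The finite sums in the
  theorem obey the same recurrences, by reversing the sums for \<open>F'\<close> and comparing coefficients.\<close>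

section \<open>Partitions with distinct odd parts: splitting off the largest part\<close>

lemma count_odd_eq_1_iff:
  "(\<forall>q \<in> set (p # \<pi>). odd q \<longrightarrow> count_list (p # \<pi>) q = 1) \<longleftrightarrow>
     (\<forall>q \<in> set \<pi>. odd q \<longrightarrow> count_list \<pi> q = 1) \<and> (odd p \<longrightarrow> p \<notin> set \<pi>)"
  by (auto simp: count_list_0_iff split: if_splits)

lemma S2_Nil [simp]: "[] \<in> S2 M"
  by (simp add: S2_def is_partition_def)

text \<open>Bounding the tail by the head \<open>p\<close> absorbs sortedness, so membership becomes
  a recursion along the list.\<close>

lemma S2_Cons_iff:
  "p # \<pi> \<in> S2 M \<longleftrightarrow> 0 < p \<and> p \<le> M \<and> \<pi> \<in> S2 p \<and> (odd p \<longrightarrow> p \<notin> set \<pi>)"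
proof -
  have "p # \<pi> \<in> S2 M \<longleftrightarrow> is_partition (p # \<pi>) \<and> (\<forall>q \<in> set (p # \<pi>). q \<le> M) \<and>
          (\<forall>q \<in> set (p # \<pi>). odd q \<longrightarrow> count_list (p # \<pi>) q = 1)"
    unfolding S2_def by blast
  then show ?thesis
    unfolding count_odd_eq_1_iff by (auto simp: S2_def is_partition_def)
qed

lemma S2_Suc_not_mem_iff: "\<pi> \<in> S2 M \<longleftrightarrow> \<pi> \<in> S2 (Suc M) \<and> Suc M \<notin> set \<pi>"
  by (auto simp: S2_def le_Suc_eq)

lemma S2_0: "S2 0 = {[]}"
proof -
  have "\<pi> = []" if "\<pi> \<in> S2 0" for \<pi>
    using that by (cases \<pi>) (auto simp: S2_Cons_iff)
  then show ?thesis by auto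
qed

lemma S2_Suc_odd:
  assumes "odd (Suc M)"
  shows "S2 (Suc M) = S2 M \<union> (#) (Suc M) ` S2 M"
proof (intro equalityI subsetI)
  fix \<pi> assume \<pi>: "\<pi> \<in> S2 (Suc M)"
  show "\<pi> \<in> S2 M \<union> (#) (Suc M) ` S2 M"
  proof (cases "Suc M \<in> set \<pi>")
    case False
    then show ?thesis using \<pi> S2_Suc_not_mem_iff by blast
  next
    case True
    then obtain p \<rho> where \<rho>: "\<pi> = p # \<rho>" by (cases \<pi>) auto
    \<comment> \<open>In a weakly decreasing list bounded by \<open>Suc M\<close>, an occurrence of
      \<open>Suc M\<close> forces the head to be \<open>Suc M\<close>.\<close>
    have "p = Suc M"
      using \<pi> True by (auto simp: \<rho> S2_Cons_iff) (auto simp: S2_def)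
    then have "\<rho> \<in> S2 (Suc M)" "Suc M \<notin> set \<rho>"
      using \<pi> assms by (auto simp: \<rho> S2_Cons_iff)
    then have "\<rho> \<in> S2 M"
      using S2_Suc_not_mem_iff by blast
    then show ?thesis
      by (simp add: \<rho> \<open>p = Suc M\<close>)
  qed
next
  fix \<pi> assume "\<pi> \<in> S2 M \<union> (#) (Suc M) ` S2 M"
  then show "\<pi> \<in> S2 (Suc M)"
    by (auto simp: S2_Cons_iff S2_Suc_not_mem_iff[of _ M])
qed

lemma S2_replicate_append:
  assumes "even (Suc M)" "\<pi> \<in> S2 (Suc M)"
  shows "replicate j (Suc M) @ \<pi> \<in> S2 (Suc M)"
  using assms by (induction j) (auto simp: S2_Cons_iff)

lemma S2_Suc_decompose:
  assumes "\<pi> \<in> S2 (Suc M)"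
  shows "\<exists>j. \<exists>\<rho> \<in> S2 M. \<pi> = replicate j (Suc M) @ \<rho>"
  using assms
proof (induction \<pi>)
  case Nil
  then show ?case by (intro exI[of _ 0] bexI[of _ "[]"]) auto
next
  case (Cons p \<pi>)
  show ?case
  proof (cases "p = Suc M")
    case True
    then obtain j \<rho> where "\<rho> \<in> S2 M" "\<pi> = replicate j (Suc M) @ \<rho>"
      using Cons by (auto simp: S2_Cons_iff)
    then show ?thesis
      using True by (intro exI[of _ "Suc j"] bexI[of _ \<rho>]) auto
  next
    case False
    then have "p # \<pi> \<in> S2 M"
      using Cons.prems by (auto simp: S2_Cons_iff)
    then show ?thesis by (intro exI[of _ 0] bexI[of _ "p # \<pi>"]) auto
  qed
qed

text \<open>The multiplicity of the even part \<open>Suc M\<close> is written as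
  \<open>2 * m\<close> plus 0 or 1. Pairs are split off because two equal rows leave the row parity
  of what lies below unchanged.\<close>

lemma S2_Suc_even_bij_betw:
  assumes "even (Suc M)"
  shows "bij_betw (\<lambda>(m, \<pi>). replicate (2 * m) (Suc M) @ \<pi>)
           (UNIV \<times> (S2 M \<union> (#) (Suc M) ` S2 M)) (S2 (Suc M))"
proof (rule bij_betw_imageI)
  let ?A = "S2 M \<union> (#) (Suc M) ` S2 M"
  have sub: "?A \<subseteq> S2 (Suc M)"
    using assms by (auto simp: S2_Cons_iff S2_Suc_not_mem_iff[of _ M])
  \<comment> \<open>The remainder holds the part at most once, so the total multiplicity determines
    \<open>m\<close> by division by 2.\<close>
  have cnt: "count_list \<pi> (Suc M) < 2" if "\<pi> \<in> ?A" for \<pi>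
    using that by (auto simp: S2_Suc_not_mem_iff[of _ M] count_list_0_iff)
  have rep: "count_list (replicate j x) x = j" for j and x :: nat
    by (induction j) auto
  show "inj_on (\<lambda>(m, \<pi>). replicate (2 * m) (Suc M) @ \<pi>) (UNIV \<times> ?A)"
  proof (rule inj_onI, clarify)
    fix m n \<pi> \<rho>
    assume A: "\<pi> \<in> ?A" "\<rho> \<in> ?A"
      and eq: "replicate (2 * m) (Suc M) @ \<pi> = replicate (2 * n) (Suc M) @ \<rho>"
    have "2 * m + count_list \<pi> (Suc M) = 2 * n + count_list \<rho> (Suc M)"
      using arg_cong[OF eq, of "\<lambda>l. count_list l (Suc M)"] by (simp add: rep)
    then have "m = n" using cnt[OF A(1)] cnt[OF A(2)] by linarith
    then show "m = n \<and> \<pi> = \<rho>" using eq by simp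
  qed
  show "(\<lambda>(m, \<pi>). replicate (2 * m) (Suc M) @ \<pi>) ` (UNIV \<times> ?A) = S2 (Suc M)"
  proof (intro equalityI subsetI)
    fix \<pi> assume "\<pi> \<in> (\<lambda>(m, \<pi>). replicate (2 * m) (Suc M) @ \<pi>) ` (UNIV \<times> ?A)"
    then show "\<pi> \<in> S2 (Suc M)"
      using sub S2_replicate_append[OF assms] by auto
  next
    fix \<pi> assume "\<pi> \<in> S2 (Suc M)"
    then obtain j \<rho> where \<rho>: "\<rho> \<in> S2 M" "\<pi> = replicate j (Suc M) @ \<rho>"
      using S2_Suc_decompose by blast
    have "\<exists>\<sigma> \<in> ?A. \<pi> = replicate (2 * (j div 2)) (Suc M) @ \<sigma>"
    proof (cases "even j")
      case True
      then show ?thesis using \<rho> by auto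
    next
      case False
      \<comment> \<open>The unpaired copy goes to the remainder, which then lies in the second set
        of the union.\<close>
      then have "replicate j (Suc M) = replicate (2 * (j div 2)) (Suc M) @ [Suc M]"
        by (metis odd_two_times_div_two_succ replicate_append_same replicate_Suc Suc_eq_plus1)
      then show ?thesis using \<rho> by (intro bexI[of _ "Suc M # \<rho>"]) auto
    qed
    then show "\<pi> \<in> (\<lambda>(m, \<pi>). replicate (2 * m) (Suc M) @ \<pi>) ` (UNIV \<times> ?A)"
      by force
  qed
qed

section \<open>Weights of diagrams row by row\<close>

lemma weight2_Nil [simp]: "weight2 [] a b c d = 1"
  by (simp add: weight2_def ferrers_cells_def)

lemma prod_alternating:
  "(\<Prod>j = 1..2 * n. if odd j then a else b) = ((a * b) ^ n :: 'a :: comm_monoid_mult)"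
  by (induction n) (auto simp: mult_ac)

text \<open>Every row of \<open>\<pi>\<close> moves down by one, so its index changes parity and its
  labels come from the other pair.\<close>

lemma weight2_Cons:
  "weight2 (p # \<pi>) a b c d = (\<Prod>j = 1..p. if odd j then a else b) * weight2 \<pi> c d a b"
proof -
  have w: "weight2 \<pi> a b c d = (\<Prod>i = 1..length \<pi>. \<Prod>j = 1..\<pi> ! (i - 1). cell_label a b c d (i, j))"
    for \<pi> and a b c d :: 'a
    unfolding weight2_def ferrers_cells_def by (subst prod.Sigma) auto
  have "(\<Prod>i = Suc 1..Suc (length \<pi>). \<Prod>j = 1..(p # \<pi>) ! (i - 1). cell_label a b c d (i, j))
          = weight2 \<pi> c d a b"
    unfolding w prod.atLeast_Suc_atMost_Suc_shift
    by (intro prod.cong refl) (auto simp: cell_label_def nth_Cons' intro!: prod.cong)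
  moreover have "{1..length (p # \<pi>)} = insert 1 {Suc 1..Suc (length \<pi>)}"
    by auto
  ultimately show ?thesis
    unfolding w[of "p # \<pi>"] by (simp add: cell_label_def del: prod.cl_ivl_Suc)
qed

lemma weight2_Cons_even:
  "weight2 (2 * n # \<pi>) a b c d = (a * b) ^ n * weight2 \<pi> c d a b"
  by (simp only: weight2_Cons prod_alternating)

lemma weight2_Cons_odd:
  "weight2 (Suc (2 * n) # \<pi>) a b c d = a * (a * b) ^ n * weight2 \<pi> c d a b"
  using prod_alternating[of a b n] by (simp add: weight2_Cons mult_ac)

text \<open>Two rows of length \<open>2 * n\<close> carry \<open>(a * b) ^ n\<close> and
  \<open>(c * d) ^ n\<close>, and two exchanges of labels cancel.\<close>

lemma weight2_replicate_even_append:
  "weight2 (replicate (2 * m) (2 * n) @ \<pi>) a b c d = ((a * b * c * d) ^ n) ^ m * weight2 \<pi> a b c d"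
proof (induction m)
  case (Suc m)
  have "replicate (2 * Suc m) (2 * n) @ \<pi> = 2 * n # 2 * n # replicate (2 * m) (2 * n) @ \<pi>"
    by simp
  then show ?case
    by (simp only: weight2_Cons_even Suc.IH) (simp add: power_mult_distrib mult_ac)
qed simp

section \<open>Infinite sums with a geometric factor\<close>

text \<open>Unconditional summability in the complex numbers is absolute. Hence the norms are
  summable over the product set, and the double sum may be evaluated as an iterated one.\<close>

lemma has_sum_geometric_product:
  fixes f :: "'a \<Rightarrow> complex"
  assumes "norm z < 1" and f: "(f has_sum s) A"
  shows "((\<lambda>(m, x). z ^ m * f x) has_sum s / (1 - z)) (UNIV \<times> A)"
proof -
  have g: "((\<lambda>m. z ^ m) has_sum 1 / (1 - z)) UNIV"
    using assms by (intro norm_summable_imp_has_sum geometric_sums)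
      (simp_all add: norm_power summable_geometric)
  have "(\<lambda>x. norm (f x)) summable_on A"
    using f summable_on_iff_abs_summable_on_complex has_sum_imp_summable by blast
  then have n: "((\<lambda>x. norm (f x)) has_sum infsum (\<lambda>x. norm (f x)) A) A"
    by (rule has_sum_infsum)
  have "(\<lambda>(m, x). norm (z ^ m * f x)) summable_on UNIV \<times> A"
  proof (rule summable_on_SigmaI)
    show "((\<lambda>x. case (m, x) of (m, x) \<Rightarrow> norm (z ^ m * f x)) has_sum
            norm (z ^ m) * infsum (\<lambda>x. norm (f x)) A) A" for m
      using has_sum_cmult_right[OF n] by (simp add: norm_mult)
    have "(\<lambda>m. norm (z ^ m)) summable_on UNIV"
      using g summable_on_iff_abs_summable_on_complex has_sum_imp_summable by blast
    then show "(\<lambda>m. norm (z ^ m) * infsum (\<lambda>x. norm (f x)) A) summable_on UNIV"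
      by (rule summable_on_cmult_left)
  qed auto
  then have "(\<lambda>(m, x). z ^ m * f x) summable_on UNIV \<times> A"
    by (subst summable_on_iff_abs_summable_on_complex) (simp add: case_prod_unfold)
  moreover have "((\<lambda>m. z ^ m * s) has_sum s / (1 - z)) UNIV"
    using has_sum_cmult_left[OF g, of s] by simp
  ultimately show ?thesis
    using has_sum_cmult_right[OF f] by (intro has_sum_SigmaI) auto
qed

section \<open>Recurrences for the finite sums\<close>

text \<open>The parameter \<open>x\<close> stands for \<open>ab\<close>; exchanging labels replaces it by \<open>y = cd\<close>, where
  \<open>Q = x y\<close>.\<close>

definition S2_sum :: "nat \<Rightarrow> nat \<Rightarrow> complex \<Rightarrow> complex \<Rightarrow> complex \<Rightarrow> complex \<Rightarrow> complex" where
  "S2_sum \<nu> N a c x Q = (\<Sum>i = 0..N. qpoch (- a) Q (N - i + \<nu>) * qpoch (- c) Q i * x ^ i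
                        / (qpoch Q Q (N - i) * qpoch Q Q i))"

lemma qpoch_Suc: "qpoch x q (Suc n) = qpoch x q n * (1 - x * q ^ n)"
  by (simp add: qpoch_def)

lemma qpoch_0 [simp]: "qpoch x q 0 = 1"
  by (simp add: qpoch_def)

lemma norm_power_less_1:
  "norm (q :: 'a :: real_normed_div_algebra) < 1 \<Longrightarrow> norm (q ^ Suc n) < 1"
  unfolding norm_power by (subst power_less_one_iff) auto

lemma qpoch_self_nonzero:
  fixes q :: complex
  assumes "norm q < 1"
  shows "qpoch q q n \<noteq> 0"
proof (induction n)
  case (Suc n)
  have "q ^ Suc n \<noteq> 1" using norm_power_less_1[OF assms, of n] by force
  then show ?case using Suc by (simp add: qpoch_Suc)
qed simp

text \<open>Reversing the summation and using
  \<open>x ^ N * y ^ (N - i) = x ^ i * Q ^ (N - i)\<close> gives the exchanged sum the same powers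
  of \<open>x\<close> and the same denominators as the original, so that the two can be compared
  term by term.\<close>

lemma S2_sum_swap:
  assumes "Q = x * y"
  shows "x ^ N * S2_sum \<nu> N c a y Q =
    (\<Sum>i = 0..N. qpoch (- a) Q (N - i) * qpoch (- c) Q (i + \<nu>) * x ^ i * Q ^ (N - i)
                        / (qpoch Q Q (N - i) * qpoch Q Q i))"
proof -
  have "S2_sum \<nu> N c a y Q = (\<Sum>i = 0..N. qpoch (- c) Q (i + \<nu>) * qpoch (- a) Q (N - i) * y ^ (N - i)
                        / (qpoch Q Q i * qpoch Q Q (N - i)))"
    unfolding S2_sum_def by (subst sum.atLeastAtMost_rev) (auto intro!: sum.cong)
  moreover have "x ^ N * (u * v * y ^ (N - i) / (w * z)) = v * u * x ^ i * Q ^ (N - i) / (z * w)"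
    if "i \<le> N" for i u v w z
  proof -
    have "x ^ N * y ^ (N - i) = x ^ i * Q ^ (N - i)"
      using that by (simp add: assms power_mult_distrib flip: power_add mult.assoc)
    then have "x ^ N * y ^ (N - i) * (u * v / (w * z)) = x ^ i * Q ^ (N - i) * (u * v / (w * z))"
      by (rule arg_cong)
    then show ?thesis by (simp add: mult_ac)
  qed
  ultimately show ?thesis
    by (simp add: sum_distrib_left)
qed

text \<open>Termwise, the last factor \<open>1 + a * Q ^ (N - i)\<close> of
  \<open>qpoch (- a) Q (N - i + 1)\<close> splits into the two summands on the right.\<close>

lemma S2_sum_odd_rec:
  assumes "Q = x * y"
  shows "S2_sum 1 N a c x Q = S2_sum 0 N a c x Q + a * x ^ N * S2_sum 0 N c a y Q"
proof -
  have "a * x ^ N * S2_sum 0 N c a y Q = a * (x ^ N * S2_sum 0 N c a y Q)" by simp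
  then show ?thesis
    unfolding S2_sum_swap[OF assms]
    by (auto simp: S2_sum_def sum_distrib_left qpoch_Suc add_divide_distrib algebra_simps
        simp flip: sum.distrib intro!: sum.cong)
qed

text \<open>All three sums are expressed as combinations of the summands \<open>T i\<close> of
  \<open>S2_sum 0 (Suc N)\<close>; it then remains to add coefficients.\<close>

lemma S2_sum_even_rec:
  assumes Q: "Q = x * y" and "norm Q < 1"
  shows "(1 - Q ^ Suc N) * S2_sum 0 (Suc N) a c x Q =
    S2_sum 1 N a c x Q + x ^ Suc N * S2_sum 1 N c a y Q"
proof -
  define T where "T i = qpoch (- a) Q (Suc N - i) * qpoch (- c) Q i * x ^ i
      / (qpoch Q Q (Suc N - i) * qpoch Q Q i)" for i
  have nz: "1 - Q ^ Suc n \<noteq> 0" for n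
    using norm_power_less_1[OF assms(2), of n] by force
  \<comment> \<open>The coefficient cancels the last factor of \<open>qpoch Q Q (Suc N - i)\<close>;
    it vanishes at \<open>i = Suc N\<close>, which allows the longer range.\<close>
  have 1: "S2_sum 1 N a c x Q = (\<Sum>i = 0..Suc N. (1 - Q ^ (Suc N - i)) * T i)"
  proof -
    have "(1 - Q ^ (Suc N - i)) * T i = qpoch (- a) Q (N - i + 1) * qpoch (- c) Q i * x ^ i
            / (qpoch Q Q (N - i) * qpoch Q Q i)" if "i \<le> N" for i
      using nz[of "N - i"] that by (simp add: T_def Suc_diff_le qpoch_Suc[of Q])
    then show ?thesis by (simp add: S2_sum_def)
  qed
  \<comment> \<open>Here the term at \<open>i = 0\<close> vanishes. After the shift to
    \<open>Suc i\<close>, the factor \<open>1 - Q ^ Suc i\<close> cancels in the denominator and one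
    \<open>x\<close> is left over.\<close>
  have 2: "x ^ Suc N * S2_sum 1 N c a y Q = (\<Sum>i = 0..Suc N. Q ^ (Suc N - i) * (1 - Q ^ i) * T i)"
  proof -
    have "Q ^ (N - i) * (1 - Q ^ Suc i) * T (Suc i) = 
       x * (qpoch (- a) Q (N - i) * qpoch (- c) Q (i + 1) * x ^ i * Q ^ (N - i)
                        / (qpoch Q Q (N - i) * qpoch Q Q i))" for i
      using nz[of i] by (simp add: T_def qpoch_Suc[of Q])
    then have "(\<Sum>i = 0..Suc N. Q ^ (Suc N - i) * (1 - Q ^ i) * T i) = x * (x ^ N * S2_sum 1 N c a y Q)"
      unfolding S2_sum_swap[OF Q]
      by (subst sum.atLeast0_atMost_Suc_shift) (simp add: sum_distrib_left)
    then show ?thesis by simp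
  qed
  have "(1 - Q ^ (Suc N - i)) + Q ^ (Suc N - i) * (1 - Q ^ i) = 1 - Q ^ Suc N" if "i \<le> Suc N" for i
    using that by (simp add: right_diff_distrib flip: power_add)
  then show ?thesis
    unfolding 1 2
    unfolding S2_sum_def add_0_right T_def[symmetric] sum_distrib_left
      sum.distrib[symmetric] distrib_right[symmetric]
    by (intro sum.cong) auto
qed

section \<open>Generating functions of \<open>S2\<close>\<close>

text \<open>This serves both parities: the union is all of \<open>S2 (Suc M)\<close> when
  \<open>Suc M\<close> is odd, and the set of remainders after removing pairs when it is
  even.\<close>

lemma has_sum_S2_union_Cons:
  fixes f :: "nat list \<Rightarrow> complex"
  assumes "(f has_sum s) (S2 M)" "((\<lambda>\<pi>. f (Suc M # \<pi>)) has_sum t) (S2 M)"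
  shows "(f has_sum s + t) (S2 M \<union> (#) (Suc M) ` S2 M)"
proof (rule has_sum_Un_disjoint[OF assms(1)])
  show "(f has_sum t) ((#) (Suc M) ` S2 M)"
    using assms(2) by (subst has_sum_reindex) (auto simp: o_def)
  show "S2 M \<inter> (#) (Suc M) ` S2 M = {}"
    by (auto simp: S2_Cons_iff)
qed

lemma has_sum_weight2_S2_odd_rec:
  fixes a b c d :: complex
  assumes "((\<lambda>\<pi>. weight2 \<pi> a b c d) has_sum s) (S2 (2 * N))"
    and "((\<lambda>\<pi>. weight2 \<pi> c d a b) has_sum t) (S2 (2 * N))"
  shows "((\<lambda>\<pi>. weight2 \<pi> a b c d) has_sum s + a * (a * b) ^ N * t) (S2 (Suc (2 * N)))"
proof -
  have "((\<lambda>\<pi>. weight2 (Suc (2 * N) # \<pi>) a b c d) has_sum a * (a * b) ^ N * t) (S2 (2 * N))"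
    using has_sum_cmult_right[OF assms(2)] by (simp only: weight2_Cons_odd)
  then show ?thesis
    by (subst S2_Suc_odd, simp) (intro has_sum_S2_union_Cons assms(1))
qed

lemma has_sum_weight2_S2_even_rec:
  fixes a b c d :: complex
  assumes "norm (a * b * c * d) < 1"
    and "((\<lambda>\<pi>. weight2 \<pi> a b c d) has_sum s) (S2 (Suc (2 * N)))"
    and "((\<lambda>\<pi>. weight2 \<pi> c d a b) has_sum t) (S2 (Suc (2 * N)))"
  shows "((\<lambda>\<pi>. weight2 \<pi> a b c d) has_sum (s + (a * b) ^ Suc N * t) / (1 - (a * b * c * d) ^ Suc N))
    (S2 (2 * Suc N))"
proof -
  have M: "Suc (Suc (2 * N)) = 2 * Suc N" by simp
  have "((\<lambda>\<pi>. weight2 (2 * Suc N # \<pi>) a b c d) has_sum (a * b) ^ Suc N * t) (S2 (Suc (2 * N)))"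
    using has_sum_cmult_right[OF assms(3)] by (simp only: weight2_Cons_even)
  then have "((\<lambda>\<pi>. weight2 \<pi> a b c d) has_sum s + (a * b) ^ Suc N * t)
          (S2 (Suc (2 * N)) \<union> (#) (2 * Suc N) ` S2 (Suc (2 * N)))"
    by (rule has_sum_S2_union_Cons[OF assms(2), unfolded M])
  then have "((\<lambda>(m, \<pi>). ((a * b * c * d) ^ Suc N) ^ m * weight2 \<pi> a b c d) has_sum
         (s + (a * b) ^ Suc N * t) / (1 - (a * b * c * d) ^ Suc N))
         (UNIV \<times> (S2 (Suc (2 * N)) \<union> (#) (2 * Suc N) ` S2 (Suc (2 * N))))"
    \<comment> \<open>The exponent \<open>Suc N\<close> is positive, so the ratio of the geometric
      series has norm below 1.\<close>
    by (intro has_sum_geometric_product norm_power_less_1 assms(1))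
  moreover have "bij_betw (\<lambda>(m, \<pi>). replicate (2 * m) (2 * Suc N) @ \<pi>)
      (UNIV \<times> (S2 (Suc (2 * N)) \<union> (#) (2 * Suc N) ` S2 (Suc (2 * N)))) (S2 (2 * Suc N))"
    using S2_Suc_even_bij_betw[of "Suc (2 * N)"] unfolding M by simp
  note has_sum_reindex_bij_betw[OF this, of "\<lambda>\<pi>. weight2 \<pi> a b c d"]
  ultimately show ?thesis
    by (simp only: case_prod_unfold weight2_replicate_even_append)
qed

lemma has_sum_weight2_S2_odd:
  fixes a b c d :: complex
  assumes Q: "Q = a * b * c * d"
    and "((\<lambda>\<pi>. weight2 \<pi> a b c d) has_sum S2_sum 0 N a c (a * b) Q) (S2 (2 * N))"
    and "((\<lambda>\<pi>. weight2 \<pi> c d a b) has_sum S2_sum 0 N c a (c * d) Q) (S2 (2 * N))"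
  shows "((\<lambda>\<pi>. weight2 \<pi> a b c d) has_sum S2_sum 1 N a c (a * b) Q) (S2 (Suc (2 * N)))"
proof -
  have "Q = (a * b) * (c * d)" by (simp add: Q mult_ac)
  from S2_sum_odd_rec[OF this] show ?thesis
    using has_sum_weight2_S2_odd_rec[OF assms(2,3)] by simp
qed

lemma has_sum_weight2_S2_even:
  fixes a b c d :: complex
  assumes "Q = a * b * c * d" "norm Q < 1"
  shows "((\<lambda>\<pi>. weight2 \<pi> a b c d) has_sum S2_sum 0 N a c (a * b) Q) (S2 (2 * N))"
  using assms(1)
\<comment> \<open>The labels must vary, since the step also needs the hypothesis with the pairs
  exchanged; \<open>Q\<close> is invariant under this exchange and stays fixed.\<close>
proof (induction N arbitrary: a b c d)
  case 0
  then show ?case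
    using has_sum_finite[of "{[]}" "\<lambda>\<pi>. weight2 \<pi> a b c d"] by (simp add: S2_0 S2_sum_def)
next
  case (Suc N)
  have swap: "Q = c * d * a * b" and Q: "Q = (a * b) * (c * d)"
    by (simp_all add: Suc.prems mult_ac)
  have odd: "((\<lambda>\<pi>. weight2 \<pi> a b c d) has_sum S2_sum 1 N a c (a * b) Q) (S2 (Suc (2 * N)))"
    "((\<lambda>\<pi>. weight2 \<pi> c d a b) has_sum S2_sum 1 N c a (c * d) Q) (S2 (Suc (2 * N)))"
    using has_sum_weight2_S2_odd Suc.IH Suc.prems swap by blast+
  have "1 - Q ^ Suc N \<noteq> 0"
    using norm_power_less_1[OF assms(2), of N] by force
  then have "S2_sum 0 (Suc N) a c (a * b) Q =
      (S2_sum 1 N a c (a * b) Q + (a * b) ^ Suc N * S2_sum 1 N c a (c * d) Q) / (1 - Q ^ Suc N)"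
    using S2_sum_even_rec[OF Q assms(2)] by (simp add: eq_divide_eq mult.commute)
  then show ?case
    using has_sum_weight2_S2_even_rec[OF _ odd] assms(2) Suc.prems by simp
qed

theorem theorem4p3:
  fixes a b c d Q :: complex and N \<nu> :: nat
  assumes Q_def: "Q = a * b * c * d"
    and conv: "norm Q < 1"
    and nu: "\<nu> \<in> {0, 1}"
  shows "(\<lambda>\<pi>. weight2 \<pi> a b c d) summable_on S2 (2 * N + \<nu>)
    \<and> (\<Sum>\<^sub>\<infinity>\<pi> \<in> S2 (2 * N + \<nu>). weight2 \<pi> a b c d)
         = (\<Sum>i = 0..N. qpoch (- a) Q (N - i + \<nu>) * qpoch (- c) Q i * (a * b) ^ i
                        / (qpoch Q Q (N - i) * qpoch Q Q i))
    \<and> (\<Sum>i = 0..N. qpoch (- a) Q (N - i + \<nu>) * qpoch (- c) Q i * (a * b) ^ i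
                        / (qpoch Q Q (N - i) * qpoch Q Q i))
         = 1 / qpoch Q Q N
           * (\<Sum>i = 0..N. qbinom Q N i * qpoch (- a) Q (N - i + \<nu>) * qpoch (- c) Q i * (a * b) ^ i)"
proof (intro conjI)
  have "((\<lambda>\<pi>. weight2 \<pi> a b c d) has_sum S2_sum \<nu> N a c (a * b) Q) (S2 (2 * N + \<nu>))"
  proof (cases "\<nu> = 0")
    case True
    then show ?thesis using has_sum_weight2_S2_even[OF Q_def conv] by simp
  next
    case False
    have "Q = c * d * a * b" by (simp add: Q_def mult_ac)
    then have "((\<lambda>\<pi>. weight2 \<pi> a b c d) has_sum S2_sum 1 N a c (a * b) Q) (S2 (Suc (2 * N)))"
      by (intro has_sum_weight2_S2_odd has_sum_weight2_S2_even Q_def conv)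
    then show ?thesis using False nu by simp
  qed
  then show "(\<lambda>\<pi>. weight2 \<pi> a b c d) summable_on S2 (2 * N + \<nu>)"
    and "(\<Sum>\<^sub>\<infinity>\<pi> \<in> S2 (2 * N + \<nu>). weight2 \<pi> a b c d)
         = (\<Sum>i = 0..N. qpoch (- a) Q (N - i + \<nu>) * qpoch (- c) Q i * (a * b) ^ i
                        / (qpoch Q Q (N - i) * qpoch Q Q i))"
    unfolding S2_sum_def by (auto simp: has_sum_imp_summable infsumI)
  show "(\<Sum>i = 0..N. qpoch (- a) Q (N - i + \<nu>) * qpoch (- c) Q i * (a * b) ^ i
                        / (qpoch Q Q (N - i) * qpoch Q Q i))
         = 1 / qpoch Q Q N
           * (\<Sum>i = 0..N. qbinom Q N i * qpoch (- a) Q (N - i + \<nu>) * qpoch (- c) Q i * (a * b) ^ i)"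
    \<comment> \<open>The numerator \<open>qpoch Q Q N\<close> of the binomial is nonzero and
      cancels against the prefactor.\<close>
    using qpoch_self_nonzero[OF conv, of N]
    by (auto simp: qbinom_def sum_distrib_left mult_ac intro!: sum.cong)
qed

end
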